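(* Let $n$ be a positive integer and let $X_1,\ldots,X_n$ be independent random variables such that $0\le X_i\le 1$ for each $i=1,\ldots,n$. Set $p=\frac1n\sum_{i=1}^n\mathbb{E}[X_i]$ and assume $p\in(0,1)$. Let $t$ be a fixed positive integer such that $$\frac{enp}{ep-p+1}\le t<n .$$ Then $$\mathbb{P}\left[\sum_{i=1}^n X_i\ge t\right]\le \frac{1+h}{e^h}\cdot\bigl(H(n,p,t)-T(n,p,t;h)\bigr)+\left(1-\frac{1+h}{e^h}\right)\mathbb{P}[B_{n,p}=t],$$ where $B_{n,p}\sim\mathrm{Bin}(n,p)$ is a binomial random variable, $$T(n,p,t;h)=\sum_{i=0}^{t-1}e^{h(i-t)}\,\mathbb{P}[B_{n,p}=i],$$ and $h$ is such that $e^h=\frac{t(1-p)}{p(n-t)}$, i.e. $h$ is the optimal real such that $\frac{1}{e^{ht}}\mathbb{E}[e^{hB_{n,p}}]=\inf_{s>0}\frac{1}{e^{st}}\mathbb{E}[e^{sB_{n,p}}]$.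
   Context: Here $e=2.718\ldots$. $\mathrm{Bin}(n,p)$ is the binomial distribution with parameters $n$ and $p$. The Hoeffding function is $$H(n,p,t)=\inf_{s>0}\left\{e^{-st}(1-p+pe^s)^n\right\}=\left(\frac{p(n-t)}{t(1-p)}\right)^{t}\left(\frac{(1-p)n}{n-t}\right)^{n},$$ for $np<t<n$. *)

theory Defs
  imports "HOL-Probability.Probability"
begin

definition hoeffding_fun :: "nat \<Rightarrow> real \<Rightarrow> real \<Rightarrow> real" where
  "hoeffding_fun n p t = (INF s\<in>{0<..}. exp (- s * t) * (1 - p + p * exp s) ^ n)"

definition hoeffding_T :: "nat \<Rightarrow> real \<Rightarrow> nat \<Rightarrow> real \<Rightarrow> real" where
  "hoeffding_T n p t h =
     (\<Sum>i<t. exp (h * (real i - real t)) * pmf (binomial_pmf n p) i)"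

(* The quantity e^{-st} E[e^{sB}], with B ~ Bin(n,p), that is minimised over s > 0. *)
definition binomial_chernoff :: "nat \<Rightarrow> real \<Rightarrow> real \<Rightarrow> real \<Rightarrow> real" where
  "binomial_chernoff n p t s =
     1 / exp (s * t) * measure_pmf.expectation (binomial_pmf n p) (\<lambda>k. exp (s * real k))"

end

theory Submission
  imports Defs
begin

text \<open>
  Write \<open>S\<close> for the sum of the \<open>X i\<close> and \<open>B\<close> for a binomial variable with parameters \<open>n\<close>
  and \<open>p\<close>.  Markov's inequality holds for any nonnegative function that is at least 1 on
  \<open>[t, \<infinity>)\<close>; the exponential \<open>exp (h * (x - t))\<close> yields the Hoeffding bound.
  Replacing it by its tangent at \<open>t\<close>, cut off at zero, loses nothing at \<open>t\<close> itself and
  gains everywhere else.  This hinge function \<open>f x = max 0 (1 + h * (x - t))\<close> is still convex,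
  so Hoeffding's comparison principle applies and the probability that \<open>S\<close> reaches \<open>t\<close> is at
  most the mean of \<open>f B\<close> (\<open>convex_tail_bound\<close>).

  The assumed lower bound on \<open>t\<close> says exactly that \<open>h \<ge> 1\<close>.  Hence the hinge
  vanishes at \<open>t - 1\<close> and below, takes the value 1 at \<open>t\<close>, and for an integer \<open>k > t\<close>
  is at most \<open>(1 + h) * exp (h * (k - t - 1))\<close> (\<open>hinge_le_exp_weight\<close>).  Summing these
  bounds against the binomial weights gives the right-hand side: \<open>hoeffding_fun\<close>
  is the full exponential sum, and subtracting \<open>hoeffding_T\<close> removes its terms below \<open>t\<close>.

  The comparison principle rests on the function \<open>bernoulli_mean\<close>, the mean of \<open>g\<close> at a sum
  of independent Bernoulli variables, as a polynomial in their parameters.  It is affine in each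
  parameter, so independence lets expectations pass inside it
  (\<open>expectation_bernoulli_mean\<close>).  For convex \<open>g\<close> it dominates \<open>g\<close> of the sum of the
  parameters (\<open>convex_le_bernoulli_mean\<close>), and it grows when the parameters are
  averaged (\<open>bernoulli_mean_le_const\<close>).

  That \<open>h\<close> is the only minimiser of the Chernoff quantity is the strict inequality between
  weighted arithmetic and geometric means (\<open>exp_mean_less_bernoulli_mgf\<close>) for the weight \<open>t / n\<close>,
  which is the success probability after tilting \<open>p\<close> by \<open>exp h\<close>.
\<close>

section \<open>Means of functions of independent Bernoulli sums\<close>

text \<open>
  The mean of \<open>g\<close> at the number of successes in independent trials with success
  probabilities \<open>x i\<close>, the sum being over the set \<open>A\<close> of successful trials.  An explicit
  polynomial, rather than an expectation, also makes sense with the random values \<open>X i \<omega>\<close>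
  as parameters.
\<close>
definition bernoulli_mean :: "'a set \<Rightarrow> ('a \<Rightarrow> real) \<Rightarrow> (nat \<Rightarrow> real) \<Rightarrow> real" where
  "bernoulli_mean I x g =
     (\<Sum>A\<in>Pow I. (\<Prod>i\<in>A. x i) * (\<Prod>i\<in>I - A. 1 - x i) * g (card A))"

lemma bernoulli_mean_empty [simp]: "bernoulli_mean {} x g = g 0"
  by (simp add: bernoulli_mean_def)

text \<open>
  Conditioning on one trial; this is also the statement that the mean is affine in each
  parameter.
\<close>
lemma bernoulli_mean_insert:
  assumes "finite I" "i \<notin> I"
  shows "bernoulli_mean (insert i I) x g =
           (1 - x i) * bernoulli_mean I x g + x i * bernoulli_mean I x (\<lambda>k. g (Suc k))"
proof -
  let ?w = "\<lambda>A. (\<Prod>j\<in>A. x j) * (\<Prod>j\<in>insert i I - A. 1 - x j) * g (card A)"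
  have inj: "inj_on (insert i) (Pow I)"
    using assms(2) by (auto simp: inj_on_def)
  have "bernoulli_mean (insert i I) x g = sum ?w (Pow I) + sum ?w (insert i ` Pow I)"
    unfolding bernoulli_mean_def Pow_insert
    using assms by (intro sum.union_disjoint) auto
  also have "sum ?w (Pow I) = (1 - x i) * bernoulli_mean I x g"
    unfolding bernoulli_mean_def sum_distrib_left
  proof (rule sum.cong[OF refl])
    fix A assume "A \<in> Pow I"
    then have "insert i I - A = insert i (I - A)" using assms by auto
    then show "?w A = (1 - x i) * ((\<Prod>j\<in>A. x j) * (\<Prod>j\<in>I - A. 1 - x j) * g (card A))"
      using assms by simp
  qed
  also have "sum ?w (insert i ` Pow I) = x i * bernoulli_mean I x (\<lambda>k. g (Suc k))"
    unfolding bernoulli_mean_def sum_distrib_left sum.reindex[OF inj] o_def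
  proof (rule sum.cong[OF refl])
    fix A assume "A \<in> Pow I"
    then have "insert i I - insert i A = I - A" "i \<notin> A" "finite A"
      using assms by (auto intro: finite_subset)
    then show "?w (insert i A) = x i * ((\<Prod>j\<in>A. x j) * (\<Prod>j\<in>I - A. 1 - x j) * g (Suc (card A)))"
      by simp
  qed
  finally show ?thesis .
qed

lemma bernoulli_mean_cong:
  assumes "\<And>i. i \<in> I \<Longrightarrow> x i = y i"
  shows "bernoulli_mean I x g = bernoulli_mean I y g"
  unfolding bernoulli_mean_def
proof (rule sum.cong[OF refl])
  fix A assume "A \<in> Pow I"
  then have "(\<Prod>i\<in>A. x i) = (\<Prod>i\<in>A. y i)" "(\<Prod>i\<in>I - A. 1 - x i) = (\<Prod>i\<in>I - A. 1 - y i)"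
    using assms by (auto intro!: prod.cong)
  then show "(\<Prod>i\<in>A. x i) * (\<Prod>i\<in>I - A. 1 - x i) * g (card A) =
      (\<Prod>i\<in>A. y i) * (\<Prod>i\<in>I - A. 1 - y i) * g (card A)" by simp
qed

lemma bernoulli_mean_add:
  "bernoulli_mean I x (\<lambda>k. g k + h k) = bernoulli_mean I x g + bernoulli_mean I x h"
  by (simp add: bernoulli_mean_def sum.distrib algebra_simps)

lemma bernoulli_mean_cmult:
  "bernoulli_mean I x (\<lambda>k. c * g k) = c * bernoulli_mean I x g"
  by (simp add: bernoulli_mean_def sum_distrib_left algebra_simps)

lemma bernoulli_mean_mono:
  assumes "\<And>i. i \<in> I \<Longrightarrow> 0 \<le> x i \<and> x i \<le> 1" "\<And>k. g k \<le> h k"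
  shows "bernoulli_mean I x g \<le> bernoulli_mean I x h"
  unfolding bernoulli_mean_def using assms
  by (intro sum_mono mult_left_mono mult_nonneg_nonneg prod_nonneg) auto

lemma bernoulli_mean_const:
  assumes "finite I" "0 \<le> p" "p \<le> 1"
  shows "bernoulli_mean I (\<lambda>_. p) g = (\<Sum>k\<le>card I. pmf (binomial_pmf (card I) p) k * g k)"
proof -
  let ?w = "\<lambda>k. p ^ k * (1 - p) ^ (card I - k) * g k"
  have "bernoulli_mean I (\<lambda>_. p) g = (\<Sum>A\<in>Pow I. ?w (card A))"
    unfolding bernoulli_mean_def using assms
    by (intro sum.cong) (auto simp: card_Diff_subset finite_subset)
  also have "\<dots> = (\<Sum>k\<le>card I. \<Sum>A\<in>{A\<in>Pow I. card A = k}. ?w (card A))"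
    by (rule sum.group[symmetric]) (use assms in \<open>auto simp: card_mono\<close>)
  also have "\<dots> = (\<Sum>k\<le>card I. real (card I choose k) * ?w k)"
    using assms by (intro sum.cong) (auto simp: n_subsets)
  finally show ?thesis using assms by (simp add: algebra_simps)
qed

section \<open>Convex comparison with the binomial distribution\<close>

text \<open>
  Each \<open>x i\<close> is the mean of a Bernoulli variable, so this is Jensen's inequality, applied to
  one summand at a time.  The shift \<open>y\<close> holds the part of the sum already treated in the
  induction.
\<close>
lemma convex_le_bernoulli_mean:
  fixes f :: "real \<Rightarrow> real"
  assumes f: "convex_on UNIV f" and "finite I" "\<And>i. i \<in> I \<Longrightarrow> 0 \<le> x i \<and> x i \<le> 1"
  shows "f (y + (\<Sum>i\<in>I. x i)) \<le> bernoulli_mean I x (\<lambda>k. f (y + real k))"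
  using assms(2,3)
proof (induction I arbitrary: y rule: finite_induct)
  case (insert i I)
  let ?s = "\<Sum>j\<in>I. x j"
  have xi: "0 \<le> x i" "x i \<le> 1" using insert.prems by auto
  have "f (y + (\<Sum>j\<in>insert i I. x j)) = f ((1 - x i) *\<^sub>R (y + ?s) + x i *\<^sub>R (y + 1 + ?s))"
    using insert.hyps by (simp add: algebra_simps)
  also have "\<dots> \<le> (1 - x i) * f (y + ?s) + x i * f (y + 1 + ?s)"
    using convex_onD[OF f] xi by blast
  also have "\<dots> \<le> (1 - x i) * bernoulli_mean I x (\<lambda>k. f (y + real k))
      + x i * bernoulli_mean I x (\<lambda>k. f (y + 1 + real k))"
    using insert xi by (intro add_mono mult_left_mono) auto
  also have "\<dots> = bernoulli_mean (insert i I) x (\<lambda>k. f (y + real k))"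
    using insert.hyps by (simp add: bernoulli_mean_insert algebra_simps)
  finally show ?case .
qed simp

text \<open>
  As a function of two of its parameters, the mean is a constant plus a multiple of their sum
  plus their product times a mean of second differences of \<open>g\<close>.  For convex \<open>g\<close> the last
  coefficient is nonnegative, so with the sum held fixed only the product matters.
\<close>
lemma bernoulli_mean_mono_prod:
  assumes I: "finite I" "i \<in> I" "j \<in> I" "i \<noteq> j"
    and g: "\<And>k. 2 * g (Suc k) \<le> g k + g (Suc (Suc k))"
    and x: "\<And>k. k \<in> I \<Longrightarrow> 0 \<le> x k \<and> x k \<le> 1"
    and eq: "\<And>k. k \<in> I - {i, j} \<Longrightarrow> y k = x k"
    and sum: "y i + y j = x i + x j" and prod: "x i * x j \<le> y i * y j"
  shows "bernoulli_mean I x g \<le> bernoulli_mean I y g"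
proof -
  define J where "J = I - {i, j}"
  have J: "finite J" "i \<notin> insert j J" "j \<notin> J" "I = insert i (insert j J)"
    using I by (auto simp: J_def)
  define a where "a = bernoulli_mean J x g"
  define b where "b = bernoulli_mean J x (\<lambda>k. g (Suc k))"
  define c where "c = bernoulli_mean J x (\<lambda>k. g (Suc (Suc k)))"
  have "2 * b \<le> a + c"
    unfolding a_def b_def c_def bernoulli_mean_cmult[symmetric] bernoulli_mean_add[symmetric]
    using x g J by (intro bernoulli_mean_mono) auto
  then have "(y i * y j - x i * x j) * (a + c - 2 * b) \<ge> 0"
    using prod by (intro mult_nonneg_nonneg) auto
  moreover have yx: "bernoulli_mean J y h = bernoulli_mean J x h" for h
    by (intro bernoulli_mean_cong) (auto simp: eq J_def)
  have expand: "bernoulli_mean I z g = a + (z i + z j) * (b - a) + z i * z j * (a + c - 2 * b)"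
    if "\<And>h. bernoulli_mean J z h = bernoulli_mean J x h" for z
    unfolding J(4) using J that
    by (simp add: bernoulli_mean_insert a_def b_def c_def algebra_simps)
  ultimately show ?thesis
    unfolding expand[of x, OF refl] expand[of y, OF yx] sum by (simp add: algebra_simps)
qed

text \<open>
  Hoeffding's theorem that, among Bernoulli sums with a given mean, the binomial one has the
  largest convex moments.  As long as the parameters are not all equal to their average \<open>p\<close>,
  one lies below \<open>p\<close> and one above.  Moving the first to \<open>p\<close> while keeping their sum brings the
  two closer together, which raises their product, and leaves fewer parameters different
  from \<open>p\<close>.
\<close>
lemma bernoulli_mean_le_const:
  assumes I: "finite I" and g: "\<And>k. 2 * g (Suc k) \<le> g k + g (Suc (Suc k))"
    and x: "\<And>k. k \<in> I \<Longrightarrow> 0 \<le> x k \<and> x k \<le> 1"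
    and mean: "(\<Sum>i\<in>I. x i) = real (card I) * p"
  shows "bernoulli_mean I x g \<le> bernoulli_mean I (\<lambda>_. p) g"
  using x mean
proof (induction "card {i \<in> I. x i \<noteq> p}" arbitrary: x rule: less_induct)
  case less
  show ?case
  proof (cases "\<forall>i\<in>I. x i = p")
    case True
    then have "bernoulli_mean I x g = bernoulli_mean I (\<lambda>_. p) g"
      by (intro bernoulli_mean_cong) auto
    then show ?thesis by simp
  next
    case False
    then obtain k where k: "k \<in> I" "x k \<noteq> p" by auto
    have sum0: "(\<Sum>i\<in>I. x i - p) = 0"
      using less.prems by (simp add: sum_subtractf)
    have "\<exists>i\<in>I. x i < p"
    proof (rule ccontr)
      assume "\<not> ?thesis"
      then have "\<forall>i\<in>I. 0 \<le> x i - p" by (auto simp: not_less)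
      then show False using sum_nonneg_eq_0_iff[OF I, of "\<lambda>i. x i - p"] sum0 k by auto
    qed
    then obtain i where i: "i \<in> I" "x i < p" by auto
    have "\<exists>j\<in>I. x j > p"
    proof (rule ccontr)
      assume "\<not> ?thesis"
      then have "\<forall>j\<in>I. x j - p \<le> 0" by (auto simp: not_less)
      then show False using sum_nonneg_eq_0_iff[OF I, of "\<lambda>i. p - x i"] sum0 k
        by (auto simp: sum_subtractf)
    qed
    then obtain j where j: "j \<in> I" "x j > p" by auto
    have ij: "i \<noteq> j" using i j by auto
    define y where "y = x(i := p, j := x i + x j - p)"
    have y: "y i = p" "y j = x i + x j - p" "\<And>k. k \<noteq> i \<Longrightarrow> k \<noteq> j \<Longrightarrow> y k = x k"
      using ij by (auto simp: y_def)
    have "0 \<le> (p - x i) * (x j - p)" using i j by simp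
    then have "x i * x j \<le> y i * y j" unfolding y(1,2) by (simp add: algebra_simps)
    then have "bernoulli_mean I x g \<le> bernoulli_mean I y g"
      using less.prems(1)
      by (intro bernoulli_mean_mono_prod[OF I i(1) j(1) ij, of g x y] g) (simp_all add: y)
    also have "\<dots> \<le> bernoulli_mean I (\<lambda>_. p) g"
    proof (rule less.hyps)
      have "{k \<in> I. y k \<noteq> p} \<subset> {k \<in> I. x k \<noteq> p}"
        using i j ij by (auto simp: y_def split: if_splits)
      then show "card {k \<in> I. y k \<noteq> p} < card {k \<in> I. x k \<noteq> p}"
        using I by (intro psubset_card_mono) auto
      show "0 \<le> y k \<and> y k \<le> 1" if "k \<in> I" for k
        using less.prems(1)[OF that] less.prems(1)[OF i(1)] less.prems(1)[OF j(1)] i j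
        by (auto simp: y_def)
      have sp: "sum z I = z i + z j + sum z (I - {i, j})" for z :: "_ \<Rightarrow> real"
      proof -
        have "sum z I = z i + sum z (I - {i})" using I i(1) by (rule sum.remove)
        also have "sum z (I - {i}) = z j + sum z (I - {i} - {j})"
          using I j(1) ij by (intro sum.remove) auto
        also have "I - {i} - {j} = I - {i, j}" by auto
        finally show ?thesis by simp
      qed
      have "sum y (I - {i, j}) = sum x (I - {i, j})"
        by (intro sum.cong) (auto simp: y)
      then show "sum y I = real (card I) * p"
        using less.prems(2) unfolding sp[of x] sp[of y] y(1,2) by simp
    qed
    finally show ?thesis .
  qed
qed

text \<open>
  Every monomial is a product of one factor \<open>X i\<close> or \<open>1 - X i\<close> for each \<open>i\<close>, and the
  expectation of such a product of independent factors is the product of the expectations.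
\<close>
lemma (in prob_space) expectation_bernoulli_mean:
  assumes I: "finite I" and ind: "indep_vars (\<lambda>_. borel) X I"
    and int: "\<And>i. i \<in> I \<Longrightarrow> integrable M (X i)"
  shows "integrable M (\<lambda>\<omega>. bernoulli_mean I (\<lambda>i. X i \<omega>) g)"
    and "expectation (\<lambda>\<omega>. bernoulli_mean I (\<lambda>i. X i \<omega>) g)
           = bernoulli_mean I (\<lambda>i. expectation (X i)) g"
proof -
  define Y where "Y A i \<omega> = (if i \<in> A then X i \<omega> else 1 - X i \<omega>)" for A i \<omega>
  have split: "(\<Prod>i\<in>I. if i \<in> A then u i else 1 - u i) = (\<Prod>i\<in>A. u i) * (\<Prod>i\<in>I - A. 1 - u i)"
    if "A \<subseteq> I" for A and u :: "_ \<Rightarrow> real"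
    using that I by (simp add: prod.If_cases Int_absorb1 Diff_eq flip: Compl_eq)
  have indY: "indep_vars (\<lambda>_. borel) (Y A) I" for A
    using indep_vars_compose2[OF ind, of "\<lambda>i v. if i \<in> A then v else 1 - v" "\<lambda>_. borel"]
    by (simp add: Y_def[abs_def])
  have intY: "integrable M (Y A i)" if "i \<in> I" for A i
    using int[OF that] by (cases "i \<in> A") (simp_all add: Y_def[abs_def])
  have EY: "expectation (Y A i) = (if i \<in> A then expectation (X i) else 1 - expectation (X i))"
    if "i \<in> I" for A i
    using int[OF that] by (cases "i \<in> A") (simp_all add: Y_def[abs_def] prob_space)
  have eq: "bernoulli_mean I (\<lambda>i. X i \<omega>) g = (\<Sum>A\<in>Pow I. (\<Prod>i\<in>I. Y A i \<omega>) * g (card A))" for \<omega>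
    unfolding bernoulli_mean_def Y_def by (intro sum.cong) (auto simp: split)
  have intP: "integrable M (\<lambda>\<omega>. \<Prod>i\<in>I. Y A i \<omega>)" for A
    using indep_vars_integrable[OF I indY intY] .
  show "integrable M (\<lambda>\<omega>. bernoulli_mean I (\<lambda>i. X i \<omega>) g)"
    unfolding eq using intP by (intro Bochner_Integration.integrable_sum) auto
  have "expectation (\<lambda>\<omega>. bernoulli_mean I (\<lambda>i. X i \<omega>) g)
      = (\<Sum>A\<in>Pow I. (\<Prod>i\<in>I. expectation (Y A i)) * g (card A))"
    unfolding eq using intP indep_vars_lebesgue_integral[OF I indY intY]
    by (simp add: Bochner_Integration.integral_sum)
  also have "\<dots> = bernoulli_mean I (\<lambda>i. expectation (X i)) g"
    unfolding bernoulli_mean_def by (intro sum.cong) (auto simp: EY split)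
  finally show "expectation (\<lambda>\<omega>. bernoulli_mean I (\<lambda>i. X i \<omega>) g)
           = bernoulli_mean I (\<lambda>i. expectation (X i)) g" .
qed

text \<open>
  Jensen's inequality is used pointwise, with the values \<open>X i \<omega>\<close> as success probabilities.
  Taking expectations turns these into the means of the \<open>X i\<close>, and averaging the means then
  produces the binomial distribution.
\<close>
lemma (in prob_space) convex_tail_bound:
  assumes I: "finite I" "I \<noteq> {}" and ind: "indep_vars (\<lambda>_. borel) X I"
    and X: "\<And>i. i \<in> I \<Longrightarrow> AE \<omega> in M. 0 \<le> X i \<omega> \<and> X i \<omega> \<le> 1"
    and p: "(\<Sum>i\<in>I. expectation (X i)) = real (card I) * p"
    and f: "convex_on UNIV f" "\<And>x. 0 \<le> f x" "\<And>x. t \<le> x \<Longrightarrow> 1 \<le> f x"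
  shows "prob {\<omega> \<in> space M. (\<Sum>i\<in>I. X i \<omega>) \<ge> t}
           \<le> (\<Sum>k\<le>card I. pmf (binomial_pmf (card I) p) k * f (real k))"
proof -
  define g where "g k = f (real k)" for k :: nat
  let ?E = "{\<omega> \<in> space M. (\<Sum>i\<in>I. X i \<omega>) \<ge> t}"
  have meas [measurable]: "X i \<in> borel_measurable M" if "i \<in> I" for i
    using ind that by (auto simp: indep_vars_def)
  have E [measurable]: "?E \<in> events" by measurable
  have int: "integrable M (X i)" if "i \<in> I" for i
    using X[OF that] meas[OF that] by (intro integrable_const_bound[of _ 1]) auto
  have mean01: "0 \<le> expectation (X i) \<and> expectation (X i) \<le> 1" if "i \<in> I" for i
    using X[OF that] int[OF that]
    by (auto intro!: integral_nonneg_AE integral_le_const)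
  have "0 \<le> real (card I) * p" "real (card I) * p \<le> real (card I) * 1"
    using sum_mono[of I "\<lambda>_. 0" "\<lambda>i. expectation (X i)"]
      sum_mono[of I "\<lambda>i. expectation (X i)" "\<lambda>_. 1"] mean01 by (auto simp: p)
  then have p01: "0 \<le> p" "p \<le> 1"
    using I by (auto simp: zero_le_mult_iff card_gt_0_iff)
  have AE01: "AE \<omega> in M. \<forall>i\<in>I. 0 \<le> X i \<omega> \<and> X i \<omega> \<le> 1"
    using I X by (intro AE_finite_allI) auto
  have "prob ?E = expectation (indicator ?E)" using E by simp
  also have "\<dots> \<le> expectation (\<lambda>\<omega>. bernoulli_mean I (\<lambda>i. X i \<omega>) g)"
  proof (rule integral_mono_AE)
    show "integrable M (indicator ?E :: 'a \<Rightarrow> real)"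
      using E by (intro integrable_real_indicator) (auto simp: less_top[symmetric])
    show "integrable M (\<lambda>\<omega>. bernoulli_mean I (\<lambda>i. X i \<omega>) g)"
      by (rule expectation_bernoulli_mean[OF I(1) ind int])
    show "AE \<omega> in M. indicator ?E \<omega> \<le> bernoulli_mean I (\<lambda>i. X i \<omega>) g"
      using AE01
    proof eventually_elim
      case (elim \<omega>)
      have "indicator ?E \<omega> \<le> f (\<Sum>i\<in>I. X i \<omega>)" using f by (auto simp: indicator_def)
      also have "\<dots> \<le> bernoulli_mean I (\<lambda>i. X i \<omega>) g"
        using convex_le_bernoulli_mean[OF f(1) I(1), of "\<lambda>i. X i \<omega>" 0] elim
        by (simp add: g_def[abs_def])
      finally show ?case .
    qed
  qed
  also have "\<dots> = bernoulli_mean I (\<lambda>i. expectation (X i)) g"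
    by (rule expectation_bernoulli_mean[OF I(1) ind int])
  also have "\<dots> \<le> bernoulli_mean I (\<lambda>_. p) g"
  proof (rule bernoulli_mean_le_const[OF I(1) _ mean01 p])
    fix k :: nat
    have "f ((1 - 1/2) *\<^sub>R real k + (1/2) *\<^sub>R real (Suc (Suc k)))
        \<le> (1 - 1/2) * f (real k) + 1/2 * f (real (Suc (Suc k)))"
      by (rule convex_onD[OF f(1)]) auto
    moreover have "(1 - 1/2) *\<^sub>R real k + (1/2) *\<^sub>R real (Suc (Suc k)) = real (Suc k)"
      by (simp add: field_simps)
    ultimately show "2 * g (Suc k) \<le> g k + g (Suc (Suc k))"
      unfolding g_def by (simp only:) simp
  qed
  also have "\<dots> = (\<Sum>k\<le>card I. pmf (binomial_pmf (card I) p) k * g k)"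
    by (rule bernoulli_mean_const[OF I(1) p01])
  finally show ?thesis by (simp add: g_def)
qed

section \<open>The minimiser of the Chernoff quantity\<close>

lemma exp_gt_add_one:
  fixes x :: real
  assumes "x \<noteq> 0"
  shows "1 + x < exp x"
proof (cases "x \<ge> -2")
  case True
  have "1 + x < (1 + x / 2)\<^sup>2" using assms by (auto simp: power2_eq_square algebra_simps zero_less_mult_iff)
  also have "\<dots> \<le> (exp (x / 2))\<^sup>2" using True by (intro power_mono exp_ge_add_one_self) auto
  also have "\<dots> = exp x" by (simp flip: exp_double)
  finally show ?thesis .
next
  case False
  then show ?thesis by (smt (verit) exp_gt_zero)
qed

text \<open>
  Strict convexity of \<open>exp\<close> at the points 0 and \<open>u\<close>.  After division by \<open>exp (q * u)\<close>
  the tangent at 0 can be used at both points \<open>- q * u\<close> and \<open>(1 - q) * u\<close>, whose weighted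
  mean is 0.
\<close>
lemma exp_mean_less_bernoulli_mgf:
  fixes q u :: real
  assumes "0 < q" "q < 1" "u \<noteq> 0"
  shows "exp (q * u) < 1 - q + q * exp u"
proof -
  have "1 = (1 - q) * (1 + - (q * u)) + q * (1 + (1 - q) * u)"
    by (simp add: algebra_simps)
  also have "\<dots> < (1 - q) * exp (- (q * u)) + q * exp ((1 - q) * u)"
    using assms by (intro add_strict_mono mult_strict_left_mono exp_gt_add_one) auto
  finally have "exp (q * u) * 1
      < exp (q * u) * ((1 - q) * exp (- (q * u)) + q * exp ((1 - q) * u))"
    by (intro mult_strict_left_mono) auto
  also have "\<dots> = 1 - q + q * exp u"
    by (simp add: algebra_simps flip: exp_add)
  finally show ?thesis by simp
qed

text \<open>
  The equation for \<open>h\<close> says that tilting a Bernoulli variable by \<open>exp h\<close> changes its success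
  probability from \<open>p\<close> to \<open>q = t / n\<close>.  Dividing the value at \<open>s\<close> by the value at \<open>h\<close>
  thus leaves \<open>(1 - q + q * exp u) ^ n / exp (q * u) ^ n\<close> with \<open>u = s - h\<close>.
\<close>
lemma chernoff_binomial_strict_min:
  fixes p h s :: real and n t :: nat
  assumes p: "0 < p" "p < 1" and t: "0 < t" "t < n"
    and h: "exp h = real t * (1 - p) / (p * (real n - real t))" and "s \<noteq> h"
  shows "exp (- h * real t) * (1 - p + p * exp h) ^ n < exp (- s * real t) * (1 - p + p * exp s) ^ n"
proof -
  define q where "q = real t / real n"
  define Z where "Z = 1 - p + p * exp h"
  have q: "0 < q" "q < 1" using t by (auto simp: q_def)
  have Z: "Z > 0" using p by (simp add: Z_def add_pos_pos)
  \<comment> \<open>\<open>Z\<close> normalises the tilted distribution, whose two weights are computed next.\<close>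
  have tn: "real n - real t > 0" using t by simp
  have qh: "p * exp h * (real n - real t) = real t * (1 - p)"
    unfolding h using p tn by (simp add: field_simps)
  then have "p * exp h * real n = real t * Z"
    by (simp add: Z_def algebra_simps)
  then have qZ: "p * exp h = q * Z" using t by (simp add: q_def field_simps)
  then have qZ': "1 - p = (1 - q) * Z" by (simp add: Z_def algebra_simps)
  have "exp s = exp h * exp (s - h)" by (simp flip: exp_add)
  then have "1 - p + p * exp s = (1 - p) + (p * exp h) * exp (s - h)" by simp
  also have "\<dots> = Z * (1 - q + q * exp (s - h))"
    unfolding qZ qZ' by (simp add: algebra_simps)
  finally have eq: "1 - p + p * exp s = Z * (1 - q + q * exp (s - h))" .
  have "exp (q * (s - h)) ^ n < (1 - q + q * exp (s - h)) ^ n"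
    using q assms by (intro power_strict_mono exp_mean_less_bernoulli_mgf) auto
  moreover have "exp (q * (s - h)) ^ n = exp ((s - h) * real t)"
    using t by (simp add: q_def flip: exp_of_nat_mult)
  ultimately have "exp (- s * real t) * Z ^ n * exp ((s - h) * real t)
      < exp (- s * real t) * Z ^ n * (1 - q + q * exp (s - h)) ^ n"
    using Z by (intro mult_strict_left_mono) auto
  moreover have "exp (- s * real t) * exp ((s - h) * real t) = exp (- h * real t)"
    by (simp add: algebra_simps flip: exp_add)
  ultimately show ?thesis
    unfolding eq Z_def[symmetric] power_mult_distrib
    by (metis (no_types, lifting) mult.assoc mult.commute)
qed

lemma binomial_chernoff_eq:
  assumes "0 \<le> p" "p \<le> 1"
  shows "binomial_chernoff n p t s = exp (- s * t) * (1 - p + p * exp s) ^ n"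
proof -
  have "measure_pmf.expectation (binomial_pmf n p) (\<lambda>k. exp (s * real k))
      = (\<Sum>k\<le>n. real (n choose k) * (p * exp s) ^ k * (1 - p) ^ (n - k))"
    using assms by (simp add: expectation_binomial_pmf' power_mult_distrib mult_ac
        flip: exp_of_nat_mult)
  also have "\<dots> = (p * exp s + (1 - p)) ^ n" by (simp add: binomial_ring)
  finally show ?thesis
    by (simp add: binomial_chernoff_def exp_minus field_simps)
qed

lemma binomial_chernoff_eq_sum:
  assumes "0 \<le> p" "p \<le> 1"
  shows "binomial_chernoff n p t s = (\<Sum>k\<le>n. exp (s * (real k - t)) * pmf (binomial_pmf n p) k)"
  using assms
  by (simp add: binomial_chernoff_def expectation_binomial_pmf' sum_distrib_left exp_diff
      right_diff_distrib mult_ac)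

section \<open>The hinge function and the improved tail bound\<close>

lemma convex_on_hinge: "convex_on UNIV (\<lambda>x::real. max 0 (1 + h * (x - t)))"
proof (rule convex_onI)
  fix u x y :: real
  assume u: "0 < u" "u < 1"
  have "1 + h * ((1 - u) *\<^sub>R x + u *\<^sub>R y - t) = (1 - u) * (1 + h * (x - t)) + u * (1 + h * (y - t))"
    by (simp add: algebra_simps)
  also have "\<dots> \<le> (1 - u) * max 0 (1 + h * (x - t)) + u * max 0 (1 + h * (y - t))"
    using u by (intro add_mono mult_left_mono) auto
  finally show "max 0 (1 + h * ((1 - u) *\<^sub>R x + u *\<^sub>R y - t))
      \<le> (1 - u) * max 0 (1 + h * (x - t)) + u * max 0 (1 + h * (y - t))"
    using u by auto
qed simp

text \<open>
  Put \<open>j = k - t - 1\<close>, a nonnegative number.  The tangent bound \<open>1 + h * j \<le> exp (h * j)\<close>, multiplied by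
  \<open>1 + h\<close>, suffices because \<open>(1 + h) * (1 + h * j)\<close> exceeds \<open>1 + h * (j + 1)\<close> by
  \<open>h\<^sup>2 * j\<close>.  The constant is the best one, since \<open>k = t + 1\<close> gives equality.
\<close>
lemma hinge_le_exp_weight:
  fixes h :: real
  assumes h: "1 \<le> h" and "k > t"
  shows "1 + h * (real k - real t) \<le> (1 + h) / exp h * exp (h * (real k - real t))"
proof -
  define j where "j = real k - real t - 1"
  have j: "j \<ge> 0" using assms by (simp add: j_def)
  have "1 + h * (j + 1) \<le> (1 + h) * (1 + h * j)"
    using h j by (simp add: algebra_simps)
  also have "\<dots> \<le> (1 + h) * exp (h * j)"
    using h by (intro mult_left_mono exp_ge_add_one_self) auto
  also have "\<dots> = (1 + h) / exp h * exp (h * (j + 1))"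
    by (simp add: distrib_left exp_add)
  finally show ?thesis by (simp add: j_def)
qed

theorem theorem1p7:
  fixes M :: "'a measure" and X :: "nat \<Rightarrow> 'a \<Rightarrow> real"
    and n t :: nat and p h :: real
  assumes "prob_space M"
    and "n > 0"
    and "prob_space.indep_vars M (\<lambda>_. borel) X {1..n}"
    and "\<And>i. i \<in> {1..n} \<Longrightarrow> AE \<omega> in M. 0 \<le> X i \<omega> \<and> X i \<omega> \<le> 1"
    and "p = 1 / real n * (\<Sum>i=1..n. prob_space.expectation M (X i))"
    and "0 < p" and "p < 1"
    and "t > 0"
    and "exp 1 * real n * p / (exp 1 * p - p + 1) \<le> real t"
    and "t < n"
    and "exp h = real t * (1 - p) / (p * (real n - real t))"
  shows "measure M {\<omega> \<in> space M. (\<Sum>i=1..n. X i \<omega>) \<ge> real t}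
           \<le> (1 + h) / exp h * (hoeffding_fun n p (real t) - hoeffding_T n p t h)
             + (1 - (1 + h) / exp h) * pmf (binomial_pmf n p) t
         \<and> 0 < h
         \<and> (\<forall>s>0. binomial_chernoff n p (real t) s
                    = (INF s'\<in>{0<..}. binomial_chernoff n p (real t) s') \<longleftrightarrow> s = h)"
proof -
  interpret prob_space M by fact
  let ?P = "pmf (binomial_pmf n p)"
  define c where "c = (1 + h) / exp h"
  define f where "f x = max 0 (1 + h * (x - real t))" for x
  have p: "0 \<le> p" "p \<le> 1" using assms by auto

  \<comment> \<open>The denominator \<open>exp 1 * p - p + 1\<close> is positive, so the assumption can be cleared of it.\<close>
  have "1 * p < exp 1 * p" using assms by (intro mult_strict_right_mono) auto
  then have "exp 1 * real n * p \<le> real t * (exp 1 * p - p + 1)"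
    using assms(9) by (simp add: pos_divide_le_eq)
  then have "exp 1 * (p * (real n - real t)) \<le> real t * (1 - p)"
    by (simp add: algebra_simps)
  then have "exp 1 \<le> exp h"
    using assms(6,10) by (simp add: assms(11) pos_le_divide_eq)
  then have h: "1 \<le> h" by simp

  have phi: "binomial_chernoff n p (real t) s = exp (- s * real t) * (1 - p + p * exp s) ^ n" for s
    by (rule binomial_chernoff_eq[OF p])
  have less: "binomial_chernoff n p (real t) h < binomial_chernoff n p (real t) s" if "s \<noteq> h" for s
    unfolding phi using chernoff_binomial_strict_min[of p t n h s] assms that by simp
  have INF: "(INF s\<in>{0<..}. binomial_chernoff n p (real t) s) = binomial_chernoff n p (real t) h"
  proof (rule cInf_eq_minimum)
    show "binomial_chernoff n p (real t) h \<in> binomial_chernoff n p (real t) ` {0<..}"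
      using h by auto
    show "binomial_chernoff n p (real t) h \<le> v" if "v \<in> binomial_chernoff n p (real t) ` {0<..}" for v
      using that less by (auto intro: less_imp_le simp: image_iff) (metis less less_le_not_le linorder_linear)
  qed
  have "hoeffding_fun n p (real t) = binomial_chernoff n p (real t) h"
    unfolding INF[symmetric] by (simp add: hoeffding_fun_def phi)
  also have "\<dots> = (\<Sum>k\<le>n. exp (h * (real k - real t)) * ?P k)"
    by (rule binomial_chernoff_eq_sum[OF p])
  also have "{..n} = {..<t} \<union> {t..n}" using assms by auto
  also have "(\<Sum>k\<in>{..<t} \<union> {t..n}. exp (h * (real k - real t)) * ?P k)
      = hoeffding_T n p t h + (\<Sum>k=t..n. exp (h * (real k - real t)) * ?P k)"
    unfolding hoeffding_T_def by (intro sum.union_disjoint) auto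
  also have "(\<Sum>k=t..n. exp (h * (real k - real t)) * ?P k)
      = ?P t + (\<Sum>k=Suc t..n. exp (h * (real k - real t)) * ?P k)"
    using assms by (subst sum.atLeast_Suc_atMost) auto
  finally have H: "hoeffding_fun n p (real t) - hoeffding_T n p t h
      = ?P t + (\<Sum>k=Suc t..n. exp (h * (real k - real t)) * ?P k)" by simp

  have mean: "(\<Sum>i\<in>{1..n}. expectation (X i)) = real (card {1..n}) * p"
    using assms by simp
  have "prob {\<omega> \<in> space M. (\<Sum>i\<in>{1..n}. X i \<omega>) \<ge> real t}
      \<le> (\<Sum>k\<le>card {1..n}. pmf (binomial_pmf (card {1..n}) p) k * f (real k))"
  proof (rule convex_tail_bound[OF _ _ assms(3,4) mean])
    show "convex_on UNIV f" unfolding f_def by (rule convex_on_hinge)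
    show "1 \<le> f x" if "real t \<le> x" for x using that h by (simp add: f_def le_max_iff_disj)
  qed (use assms in \<open>auto simp: f_def\<close>)
  also have "\<dots> = (\<Sum>k\<le>n. ?P k * f (real k))" by simp
  also have "\<dots> = (\<Sum>k=t..n. ?P k * f (real k))"
  proof (rule sum.mono_neutral_right)
    show "\<forall>k\<in>{..n} - {t..n}. ?P k * f (real k) = 0"
    proof
      \<comment> \<open>The zero \<open>t - 1 / h\<close> of the tangent lies in \<open>[t - 1, t)\<close> because \<open>h \<ge> 1\<close>.\<close>
      fix k assume "k \<in> {..n} - {t..n}"
      then have "real k - real t \<le> -1" by auto
      then have "h * (real k - real t) \<le> h * -1" using h by (intro mult_left_mono) auto
      then show "?P k * f (real k) = 0" using h by (simp add: f_def)
    qed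
  qed auto
  also have "\<dots> = ?P t + (\<Sum>k=Suc t..n. ?P k * f (real k))"
    using assms by (subst sum.atLeast_Suc_atMost) (auto simp: f_def)
  also have "\<dots> \<le> ?P t + (\<Sum>k=Suc t..n. ?P k * (c * exp (h * (real k - real t))))"
  proof (intro add_left_mono sum_mono mult_left_mono pmf_nonneg)
    fix k assume "k \<in> {Suc t..n}"
    then have "1 + h * (real k - real t) \<le> c * exp (h * (real k - real t))"
      unfolding c_def using h by (intro hinge_le_exp_weight) auto
    moreover have "0 \<le> c * exp (h * (real k - real t))" using h by (simp add: c_def)
    ultimately show "f (real k) \<le> c * exp (h * (real k - real t))" by (simp add: f_def)
  qed
  also have "\<dots> = c * (hoeffding_fun n p (real t) - hoeffding_T n p t h) + (1 - c) * ?P t"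
    unfolding H by (simp add: algebra_simps sum_distrib_left)
  finally have "prob {\<omega> \<in> space M. (\<Sum>i=1..n. X i \<omega>) \<ge> real t}
      \<le> c * (hoeffding_fun n p (real t) - hoeffding_T n p t h) + (1 - c) * ?P t" .
  moreover have "\<forall>s>0. binomial_chernoff n p (real t) s
      = (INF s'\<in>{0<..}. binomial_chernoff n p (real t) s') \<longleftrightarrow> s = h"
    unfolding INF using less by (metis less_irrefl)
  ultimately show ?thesis using h unfolding c_def by simp
qed

end
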